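(* Let $G=(V,E)$ be a finite weighted graph, let $\Omega\subseteq V$ be a domain such that $\Omega^\circ\neq\emptyset$, and let $\Delta_\Omega$ be the Dirichlet Laplacian on $\Omega^\circ$. Let $g,h:\Omega^\circ\to\mathbb{R}$ and let $f:[0,\infty)\times\Omega^\circ\to\mathbb{R}$ be continuous with respect to $t$. Assume that there exist positive constants $\alpha$ and $c=c(\Omega^\circ)$ such that $$\|f(t,\cdot)-f(s,\cdot)\|_{L^2(\Omega^\circ)}\le c|t-s|^\alpha\qquad\text{for any } t,s\in[0,\infty).$$ Then the initial boundary value problem $$\begin{cases}\partial_t^2u(t,x)-\Delta_\Omega u(t,x)=f(t,x), & (t,x)\in[0,\infty)\times\Omega^\circ,\\ u(0,x)=g(x), & x\in\Omega^\circ,\\ \partial_tu(0,x)=h(x), & x\in\Omega^\circ,\\ u(t,x)=0, & (t,x)\in[0,\infty)\times\partial\Omega\end{cases}$$ has a unique solution $u:[0,\infty)\times\Omega\to\mathbb{R}$.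
   Context: A finite weighted graph $G=(V,E)$ is a finite graph with vertex set $V$ and edge set $E$ (write $y\sim x$ if $xy\in E$), with edge weights $\omega_{xy}=\omega_{yx}>0$ for every $xy\in E$, together with a positive finite measure $\mu:V\to(0,\infty)$. A domain $\Omega\subseteq V$ is a non-empty connected set of vertices. Its boundary is the set $\partial\Omega:=\{x\in\Omega:\text{ there exists }y\in\Omega^c\text{ with }y\sim x\}$ (a subset of $\Omega$), and its interior is $\Omega^\circ:=\Omega\setminus\partial\Omega$. For a function $u$ on $\Omega^\circ$, the Dirichlet Laplacian is $$\Delta_\Omega u(x)=\frac{1}{\mu(x)}\sum_{y\sim x}\omega_{xy}\,(u(y)-u(x)),\qquad x\in\Omega^\circ,$$ where $u(y):=0$ whenever $y\notin\Omega^\circ$; it is applied to $u(t,\cdot)$ for each fixed $t$. The norm is $\|v\|_{L^2(\Omega^\circ)}^2=\sum_{x\in\Omega^\circ}|v(x)|^2\mu(x)$. A function $u:[0,\infty)\times\Omega\to\mathbb{R}$ is a solution of the problem if $u$ is twice continuously differentiable with respect to $t$ and all the equations of the problem are satisfied (derivatives at $t=0$ are one-sided). *)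

theory Defs
  imports
    "HOL-Analysis.Analysis"
    "Graph_Theory.Pair_Digraph"
    "Graph_Theory.Digraph_Component"
begin

text \<open>
  An undirected edge \<open>xy\<close> is the pair of arcs \<open>(x, y)\<close> and \<open>(y, x)\<close>.
  The locale \<^locale>\<open>pair_pseudo_graph\<close> demands a finite vertex set and a symmetric arc set and
  leaves open whether loops occur; a loop contributes nothing to the boundary or to the Laplacian.
\<close>

locale weighted_graph = pair_pseudo_graph G for G :: "'a pair_pre_digraph" +
  fixes \<omega> :: "'a \<Rightarrow> 'a \<Rightarrow> real" and \<mu> :: "'a \<Rightarrow> real"
  assumes weight_sym: "(x, y) \<in> parcs G \<Longrightarrow> \<omega> x y = \<omega> y x"
    and weight_pos: "(x, y) \<in> parcs G \<Longrightarrow> \<omega> x y > 0"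
    and measure_pos: "x \<in> pverts G \<Longrightarrow> \<mu> x > 0"

text \<open>The name \<open>connected\<close> alone would be ambiguous with topological connectedness.\<close>

definition graph_domain :: "'a pair_pre_digraph \<Rightarrow> 'a set \<Rightarrow> bool" where
  "graph_domain G \<Omega> \<longleftrightarrow>
     \<Omega> \<subseteq> pverts G \<and> \<Omega> \<noteq> {} \<and> Digraph_Component.connected (with_proj G \<restriction> \<Omega>)"

definition graph_boundary :: "'a pair_pre_digraph \<Rightarrow> 'a set \<Rightarrow> 'a set" where
  "graph_boundary G \<Omega> = {x \<in> \<Omega>. \<exists>y \<in> pverts G - \<Omega>. (x, y) \<in> parcs G}"

definition graph_interior :: "'a pair_pre_digraph \<Rightarrow> 'a set \<Rightarrow> 'a set" where
  "graph_interior G \<Omega> = \<Omega> - graph_boundary G \<Omega>"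

text \<open>Only the values of \<open>v\<close> on the interior of \<open>\<Omega>\<close> enter when \<open>x\<close> lies in the interior.\<close>

definition dirichlet_laplacian ::
  "'a pair_pre_digraph \<Rightarrow> ('a \<Rightarrow> 'a \<Rightarrow> real) \<Rightarrow> ('a \<Rightarrow> real) \<Rightarrow> 'a set \<Rightarrow> ('a \<Rightarrow> real) \<Rightarrow> 'a \<Rightarrow> real"
where
  "dirichlet_laplacian G \<omega> \<mu> \<Omega> v x =
     1 / \<mu> x * (\<Sum>y | (x, y) \<in> parcs G.
                   \<omega> x y * ((if y \<in> graph_interior G \<Omega> then v y else 0) - v x))"

definition l2_norm :: "('a \<Rightarrow> real) \<Rightarrow> 'a set \<Rightarrow> ('a \<Rightarrow> real) \<Rightarrow> real" where
  "l2_norm \<mu> W v = sqrt (\<Sum>x\<in>W. \<bar>v x\<bar>\<^sup>2 * \<mu> x)"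

text \<open>
  Time derivatives are taken within \<open>[0, \<infinity>)\<close>, hence one-sided at \<open>t = 0\<close>.
  The value of \<^const>\<open>vector_derivative\<close> is meaningful only where the derivative exists, so
  existence is stated separately in \<open>time_C2\<close>.
\<close>

definition time_deriv :: "(real \<times> 'a \<Rightarrow> real) \<Rightarrow> real \<times> 'a \<Rightarrow> real" where
  "time_deriv u = (\<lambda>(t, x). vector_derivative (\<lambda>s. u (s, x)) (at t within {0..}))"

definition time_C2 :: "'a set \<Rightarrow> (real \<times> 'a \<Rightarrow> real) \<Rightarrow> bool" where
  "time_C2 \<Omega> u \<longleftrightarrow>
     (\<forall>x\<in>\<Omega>. (\<lambda>t. u (t, x)) differentiable_on {0..} \<and>
            (\<lambda>t. time_deriv u (t, x)) differentiable_on {0..} \<and>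
            continuous_on {0..} (\<lambda>t. time_deriv (time_deriv u) (t, x)))"

definition wave_solution ::
  "'a pair_pre_digraph \<Rightarrow> ('a \<Rightarrow> 'a \<Rightarrow> real) \<Rightarrow> ('a \<Rightarrow> real) \<Rightarrow> 'a set \<Rightarrow>
   (real \<times> 'a \<Rightarrow> real) \<Rightarrow> ('a \<Rightarrow> real) \<Rightarrow> ('a \<Rightarrow> real) \<Rightarrow> (real \<times> 'a \<Rightarrow> real) \<Rightarrow> bool"
where
  "wave_solution G \<omega> \<mu> \<Omega> f g h u \<longleftrightarrow>
     time_C2 \<Omega> u \<and>
     (\<forall>t\<ge>0. \<forall>x\<in>graph_interior G \<Omega>.
        time_deriv (time_deriv u) (t, x)
          - dirichlet_laplacian G \<omega> \<mu> \<Omega> (\<lambda>y. u (t, y)) x = f (t, x)) \<and>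
     (\<forall>x\<in>graph_interior G \<Omega>. u (0, x) = g x) \<and>
     (\<forall>x\<in>graph_interior G \<Omega>. time_deriv u (0, x) = h x) \<and>
     (\<forall>t\<ge>0. \<forall>x\<in>graph_boundary G \<Omega>. u (t, x) = 0)"

end

theory Submission
  imports Defs
begin

text \<open>
  Since the graph is finite, the wave equation is a linear system of second-order ordinary
  differential equations with continuous forcing, indexed by the interior of \<open>\<Omega>\<close>. Written as a
  first-order system \<open>y' = A y + F\<close>, it is solved by the Picard series \<open>\<Sum>k. y\<^sub>k\<close> with
  \<open>y\<^sub>0 t = c + \<integral>\<^sub>0\<^sup>t F\<close> and \<open>y\<^sub>k\<^sub>+\<^sub>1 t = \<integral>\<^sub>0\<^sup>t A y\<^sub>k\<close>. On \<open>[0, T]\<close> its terms are bounded by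
  \<open>M (C t)\<^sup>k / k!\<close>, so it may be differentiated term by term. Uniqueness is Gronwall's inequality.
\<close>

section \<open>Linear systems of ordinary differential equations\<close>

text \<open>These are the increments of Picard iteration, not the iterates. The data
  \<open>b\<close> sit entirely in term 0, so every later term obeys a homogeneous recursion and the
  formal sum solves \<open>y = b + integral of a y\<close>.\<close>

primrec picard_term ::
  "'j set \<Rightarrow> ('j \<Rightarrow> 'j \<Rightarrow> real) \<Rightarrow> (real \<Rightarrow> 'j \<Rightarrow> real) \<Rightarrow> nat \<Rightarrow> real \<Rightarrow> 'j \<Rightarrow> real"
where
  "picard_term J a b 0 = b"
| "picard_term J a b (Suc k) =
     (\<lambda>t j. integral {0..t} (\<lambda>s. \<Sum>i\<in>J. a j i * picard_term J a b k s i))"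

lemma continuous_on_picard_term:
  assumes b: "\<And>j. j \<in> J \<Longrightarrow> continuous_on {0..T} (\<lambda>t. b t j)" and "j \<in> J"
  shows "continuous_on {0..T} (\<lambda>t. picard_term J a b k t j)"
  using \<open>j \<in> J\<close>
proof (induction k arbitrary: j)
  case (Suc k)
  have "continuous_on {0..T} (\<lambda>s. \<Sum>i\<in>J. a j i * picard_term J a b k s i)"
    using Suc.IH by (intro continuous_intros) auto
  then show ?case
    by (simp add: indefinite_integral_continuous_1 integrable_continuous_interval)
qed (use b in simp)

lemma picard_term_has_real_derivative:
  assumes "\<And>j. j \<in> J \<Longrightarrow> continuous_on {0..T} (\<lambda>t. b t j)" and "t \<in> {0..T}"
  shows "((\<lambda>t. picard_term J a b (Suc k) t j) has_real_derivative
           (\<Sum>i\<in>J. a j i * picard_term J a b k t i)) (at t within {0..T})"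
proof -
  have "continuous_on {0..T} (\<lambda>s. \<Sum>i\<in>J. a j i * picard_term J a b k s i)"
    using assms(1) by (intro continuous_intros continuous_on_picard_term) auto
  from integral_has_real_derivative[OF this assms(2)] show ?thesis by simp
qed

text \<open>The sum of the absolute values of all entries dominates every single row sum. Being
  independent of \<open>j\<close>, it can be carried through the recursion as one constant.\<close>

lemma abs_row_sum_le:
  fixes a :: "'j \<Rightarrow> 'j \<Rightarrow> real"
  assumes "finite J" "j \<in> J" and "\<And>i. i \<in> J \<Longrightarrow> \<bar>z i\<bar> \<le> B" and "0 \<le> B"
  shows "\<bar>\<Sum>i\<in>J. a j i * z i\<bar> \<le> (\<Sum>k\<in>J. \<Sum>i\<in>J. \<bar>a k i\<bar>) * B"
proof -
  have "\<bar>\<Sum>i\<in>J. a j i * z i\<bar> \<le> (\<Sum>i\<in>J. \<bar>a j i * z i\<bar>)"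
    by (rule sum_abs)
  also have "\<dots> \<le> (\<Sum>i\<in>J. \<bar>a j i\<bar>) * B"
    unfolding sum_distrib_right abs_mult using assms by (intro sum_mono mult_left_mono) auto
  also have "\<dots> \<le> (\<Sum>k\<in>J. \<Sum>i\<in>J. \<bar>a k i\<bar>) * B"
    using assms by (intro mult_right_mono member_le_sum[of j J "\<lambda>k. \<Sum>i\<in>J. \<bar>a k i\<bar>"])
      (auto intro: sum_nonneg)
  finally show ?thesis .
qed

text \<open>Induction on \<open>k\<close>: each step multiplies the bound by \<open>C\<close> and
  integrates it, and the repeated integration of powers of \<open>t\<close> from 0 produces the
  factorial.\<close>

lemma abs_picard_term_le:
  assumes J: "finite J" and b: "\<And>j. j \<in> J \<Longrightarrow> continuous_on {0..T} (\<lambda>t. b t j)"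
    and M: "\<And>j t. j \<in> J \<Longrightarrow> t \<in> {0..T} \<Longrightarrow> \<bar>b t j\<bar> \<le> M" and "0 \<le> M"
    and C: "C = (\<Sum>k\<in>J. \<Sum>i\<in>J. \<bar>a k i\<bar>)"
    and "j \<in> J" "t \<in> {0..T}"
  shows "\<bar>picard_term J a b k t j\<bar> \<le> M * (C * t) ^ k / fact k"
  using \<open>j \<in> J\<close> \<open>t \<in> {0..T}\<close>
proof (induction k arbitrary: j t)
  case (Suc k)
  have C0: "0 \<le> C" unfolding C by (intro sum_nonneg) auto
  define \<phi> where "\<phi> = (\<lambda>s. \<Sum>i\<in>J. a j i * picard_term J a b k s i)"
  \<comment> \<open>\<open>C\<close> times the induction hypothesis. It is the derivative of the
    bound for \<open>Suc k\<close>, and that bound vanishes at 0.\<close>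
  define \<psi> where "\<psi> = (\<lambda>s. C * (M * (C * s) ^ k / fact k))"
  have "continuous_on {0..T} \<phi>"
    unfolding \<phi>_def using b by (intro continuous_intros continuous_on_picard_term) auto
  then have int: "\<phi> integrable_on {0..t}"
    using Suc.prems by (intro integrable_continuous_interval) (auto elim: continuous_on_subset)
  have "(\<psi> has_integral (M * (C * t) ^ Suc k / fact (Suc k) - M * (C * 0) ^ Suc k / fact (Suc k))) {0..t}"
    using Suc.prems
  proof (intro fundamental_theorem_of_calculus)
    fix s assume "s \<in> {0..t}"
    have "((\<lambda>s. M * (C * s) ^ Suc k / fact (Suc k)) has_real_derivative
            M * (real (Suc k) * (C * s) ^ k * C) / fact (Suc k)) (at s within {0..t})"
      by (auto intro!: derivative_eq_intros simp del: fact_Suc power_Suc)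
    also have "M * (real (Suc k) * (C * s) ^ k * C) / fact (Suc k) = \<psi> s"
      by (simp add: \<psi>_def divide_simps del: of_nat_Suc)
    finally show "((\<lambda>s. M * (C * s) ^ Suc k / fact (Suc k)) has_vector_derivative \<psi> s)
        (at s within {0..t})"
      by (simp only: has_real_derivative_iff_has_vector_derivative)
  qed auto
  then have \<psi>: "(\<psi> has_integral M * (C * t) ^ Suc k / fact (Suc k)) {0..t}" by simp
  have "norm (integral {0..t} \<phi>) \<le> integral {0..t} \<psi>"
  proof (rule integral_norm_bound_integral[OF int])
    show "\<psi> integrable_on {0..t}" using \<psi> by blast
  next
    fix s assume s: "s \<in> {0..t}"
    have "\<bar>\<phi> s\<bar> \<le> (\<Sum>k\<in>J. \<Sum>i\<in>J. \<bar>a k i\<bar>) * (M * (C * s) ^ k / fact k)"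
      unfolding \<phi>_def using s Suc J C0 \<open>0 \<le> M\<close> by (intro abs_row_sum_le) auto
    then show "norm (\<phi> s) \<le> \<psi> s" by (simp add: \<psi>_def C)
  qed
  then show ?case
    using \<psi> by (simp add: \<phi>_def integral_unique)
qed (use M in simp)

text \<open>The series is defined for all times at once, so nothing has to be glued. Only
  convergence and differentiability are argued on compact intervals \<open>{0..T}\<close>.\<close>

lemma linear_ode_exists:
  fixes a :: "'j \<Rightarrow> 'j \<Rightarrow> real" and F :: "real \<Rightarrow> 'j \<Rightarrow> real"
  assumes J: "finite J" and F: "\<And>j. j \<in> J \<Longrightarrow> continuous_on {0..} (\<lambda>t. F t j)"
  shows "\<exists>y. (\<forall>j\<in>J. y 0 j = c j) \<and>
           (\<forall>j\<in>J. \<forall>t\<ge>0. ((\<lambda>t. y t j) has_real_derivative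
              (\<Sum>i\<in>J. a j i * y t i) + F t j) (at t within {0..}))"
proof -
  define b where "b = (\<lambda>t j. c j + integral {0..t} (\<lambda>s. F s j))"
  define Y where "Y = picard_term J a b"
  define y where "y = (\<lambda>t j. \<Sum>k. Y k t j)"
  define C where "C = (\<Sum>k\<in>J. \<Sum>i\<in>J. \<bar>a k i\<bar>)"
  have C0: "0 \<le> C" unfolding C_def by (intro sum_nonneg) auto
  have F': "continuous_on {0..T} (\<lambda>t. F t j)" if "j \<in> J" for j T
    using F[OF that] by (rule continuous_on_subset) auto
  have b': "((\<lambda>t. b t j) has_real_derivative F t j) (at t within {0..T})"
    if "j \<in> J" "t \<in> {0..T}" for j t T
    unfolding b_def using integral_has_real_derivative[OF F' that(2)] that(1)
    by (auto intro!: derivative_eq_intros)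
  have contb: "continuous_on {0..T} (\<lambda>t. b t j)" if "j \<in> J" for j T
    using b'[OF that] by (intro DERIV_continuous_on)
  \<comment> \<open>\<open>M\<close> depends on \<open>T\<close> only. Replacing \<open>t\<close> by
    \<open>T\<close> in the power gives a majorant free of \<open>t\<close>, as the Weierstrass test
    requires.\<close>
  have bound: "\<exists>M\<ge>0. \<forall>j\<in>J. \<forall>t\<in>{0..T}. \<forall>k. \<bar>Y k t j\<bar> \<le> M * ((C * T) ^ k / fact k)" for T
  proof -
    have "\<exists>m. \<forall>t\<in>{0..T}. \<bar>b t j\<bar> \<le> m" if "j \<in> J" for j
      using compact_continuous_image[OF contb[OF that]] compact_imp_bounded
      by (fastforce simp: bounded_iff)
    then obtain m where m: "\<And>j t. j \<in> J \<Longrightarrow> t \<in> {0..T} \<Longrightarrow> \<bar>b t j\<bar> \<le> m j" by metis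
    define M where "M = (\<Sum>j\<in>J. \<bar>m j\<bar>)"
    have M0: "0 \<le> M" unfolding M_def by (intro sum_nonneg) auto
    have M: "\<bar>b t j\<bar> \<le> M" if "j \<in> J" "t \<in> {0..T}" for j t
      using m[OF that] member_le_sum[of j J "\<lambda>j. \<bar>m j\<bar>"] J that(1) by (auto simp: M_def)
    have "\<bar>Y k t j\<bar> \<le> M * ((C * T) ^ k / fact k)" if "j \<in> J" "t \<in> {0..T}" for j t k
    proof -
      have "\<bar>Y k t j\<bar> \<le> M * (C * t) ^ k / fact k"
        unfolding Y_def by (rule abs_picard_term_le[OF J contb M M0 C_def that])
      also have "\<dots> \<le> M * (C * T) ^ k / fact k"
        using that M0 C0 by (intro divide_right_mono mult_left_mono power_mono) auto
      finally show ?thesis by simp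
    qed
    then show ?thesis using M0 by blast
  qed
  have summ_exp: "summable (\<lambda>k. M * ((C * T) ^ k / fact k))" for M T :: real
    using summable_exp[of "C * T"] by (intro summable_mult) (simp add: field_simps)
  have summ: "summable (\<lambda>k. Y k t j)" if "j \<in> J" "0 \<le> t" for j t
  proof -
    obtain M where "\<forall>k. \<bar>Y k t j\<bar> \<le> M * ((C * t) ^ k / fact k)"
      using bound[of t] \<open>j \<in> J\<close> \<open>0 \<le> t\<close> by (metis atLeastAtMost_iff order.refl)
    then show ?thesis
      using summable_comparison_test'[OF summ_exp[of M t], of 0 "\<lambda>k. Y k t j"] by simp
  qed
  have deriv: "((\<lambda>t. y t j) has_real_derivative (\<Sum>i\<in>J. a j i * y t i) + F t j) (at t within {0..T})"
    if j: "j \<in> J" and t: "t \<in> {0..T}" for j t T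
  proof -
    obtain M where M: "0 \<le> M" "\<And>j t k. j \<in> J \<Longrightarrow> t \<in> {0..T} \<Longrightarrow> \<bar>Y k t j\<bar> \<le> M * ((C * T) ^ k / fact k)"
      using bound[of T] by blast
    have unif: "uniform_limit {0..T} (\<lambda>n t. \<Sum>k<n. \<Sum>i\<in>J. a j i * Y k t i)
      (\<lambda>t. \<Sum>k. \<Sum>i\<in>J. a j i * Y k t i) sequentially"
    proof (rule Weierstrass_m_test)
      show "summable (\<lambda>k. C * (M * ((C * T) ^ k / fact k)))"
        by (intro summable_mult[OF summ_exp])
      show "norm (\<Sum>i\<in>J. a j i * Y k s i) \<le> C * (M * ((C * T) ^ k / fact k))"
        if "s \<in> {0..T}" for k s
        unfolding real_norm_def
        by (rule abs_row_sum_le[OF J j, where a = a, folded C_def]) (use M that t C0 in auto)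
    qed
    have "(\<Sum>k. \<Sum>i\<in>J. a j i * Y k s i) = (\<Sum>i\<in>J. a j i * y s i)" if "s \<in> {0..T}" for s
    proof -
      have "(\<lambda>k. \<Sum>i\<in>J. a j i * Y k s i) sums (\<Sum>i\<in>J. a j i * y s i)"
        unfolding y_def using that
        by (intro sums_sum sums_mult summable_sums summ) auto
      then show ?thesis by (simp add: sums_iff)
    qed
    then have unif: "uniform_limit {0..T} (\<lambda>n t. \<Sum>k<n. \<Sum>i\<in>J. a j i * Y k t i)
      (\<lambda>t. \<Sum>i\<in>J. a j i * y t i) sequentially"
      by (intro uniform_limit_cong'[THEN iffD1, OF _ _ unif]) auto
    \<comment> \<open>Term 0 is left out because its derivative is \<open>F\<close>. With the index
      shifted by one, term \<open>Suc k\<close> differentiates to row \<open>j\<close> applied to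
      term \<open>k\<close>, so the differentiated series sums to row \<open>j\<close> applied to
      \<open>y\<close>.\<close>
    have dY: "((\<lambda>t. Y (Suc k) t j) has_real_derivative (\<Sum>i\<in>J. a j i * Y k s i)) (at s within {0..T})"
      if "s \<in> {0..T}" for k s
      unfolding Y_def using contb that by (intro picard_term_has_real_derivative)
    \<comment> \<open>Termwise differentiation needs one point of convergence. At time 0 all these
      terms are integrals over a single point, hence zero.\<close>
    have "summable (\<lambda>k. Y (Suc k) 0 j)"
      by (simp add: Y_def)
    then have "\<exists>w. \<forall>t\<in>{0..T}. (\<lambda>k. Y (Suc k) t j) sums w t \<and>
      (w has_real_derivative (\<Sum>i\<in>J. a j i * y t i)) (at t within {0..T})"
      using t by (intro has_field_derivative_series[OF _ dY unif, where ?x0.0 = 0]) auto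
    then obtain w where w: "\<And>t. t \<in> {0..T} \<Longrightarrow> (\<lambda>k. Y (Suc k) t j) sums w t"
      "\<And>t. t \<in> {0..T} \<Longrightarrow> (w has_real_derivative (\<Sum>i\<in>J. a j i * y t i)) (at t within {0..T})"
      by blast
    have "y s j = w s + b s j" if "s \<in> {0..T}" for s
      using w(1)[OF that] sums_Suc[of "\<lambda>k. Y k s j"] by (simp add: y_def sums_iff Y_def)
    then show ?thesis
      using DERIV_add[OF w(2)[OF t] b'[OF j t]] t
      by (elim has_field_derivative_transform_within[where d = 1]) auto
  qed
  have "((\<lambda>t. y t j) has_real_derivative (\<Sum>i\<in>J. a j i * y t i) + F t j) (at t within {0..})"
    if "j \<in> J" "0 \<le> t" for j t
  proof -
    \<comment> \<open>Both sets agree near \<open>t\<close>, including at the endpoint 0, so the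
      derivative within the compact interval is the one within the half-line.\<close>
    have "at t within {0..} = at t within {0..t + 1}"
      by (rule at_within_nhd[of t "{..<t + 1}"]) auto
    then show ?thesis using deriv[of j t "t + 1"] that by simp
  qed
  moreover have "y 0 j = c j" if "j \<in> J" for j
  proof -
    have "Y k 0 j = (if k = 0 then c j else 0)" for k
      by (cases k) (auto simp: Y_def b_def)
    then show ?thesis
      using sums_single[of 0 "\<lambda>_. c j"] by (simp add: y_def sums_iff)
  qed
  ultimately show ?thesis by blast
qed

text \<open>Gronwall's argument for the energy \<open>\<Sum>j\<in>J. (z t j)\<^sup>2\<close>.\<close>

lemma linear_ode_zero:
  fixes a :: "'j \<Rightarrow> 'j \<Rightarrow> real"
  assumes J: "finite J"
    and init: "\<And>j. j \<in> J \<Longrightarrow> z 0 j = 0"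
    and deriv: "\<And>j t. j \<in> J \<Longrightarrow> 0 \<le> t \<Longrightarrow>
      ((\<lambda>t. z t j) has_real_derivative (\<Sum>i\<in>J. a j i * z t i)) (at t within {0..})"
    and "j \<in> J" "0 \<le> t"
  shows "z t j = 0"
proof -
  define E where "E = (\<lambda>t. \<Sum>j\<in>J. (z t j)\<^sup>2)"
  define E' where "E' = (\<lambda>t. \<Sum>j\<in>J. 2 * z t j * (\<Sum>i\<in>J. a j i * z t i))"
  define K where "K = 2 * (\<Sum>j\<in>J. \<Sum>i\<in>J. \<bar>a j i\<bar>)"
  have zE: "(z s i)\<^sup>2 \<le> E s" if "i \<in> J" for s i
    unfolding E_def using member_le_sum[of i J "\<lambda>i. (z s i)\<^sup>2"] J that by auto
  have E'_le: "E' s \<le> K * E s" for s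
  proof -
    \<comment> \<open>By \<open>2 p q \<le> p^2 + q^2\<close>, each mixed product is at most the
      whole energy.\<close>
    have *: "z s k * (a k i * z s i) \<le> \<bar>a k i\<bar> * E s" if "i \<in> J" "k \<in> J" for i k
    proof -
      have "\<bar>z s k * z s i\<bar> \<le> ((z s k)\<^sup>2 + (z s i)\<^sup>2) / 2"
        using sum_squares_bound[of "\<bar>z s k\<bar>" "\<bar>z s i\<bar>"] by (simp add: abs_mult)
      also have "\<dots> \<le> E s" using zE[OF that(1), of s] zE[OF that(2), of s] by simp
      finally have "\<bar>a k i\<bar> * \<bar>z s k * z s i\<bar> \<le> \<bar>a k i\<bar> * E s" by (rule mult_left_mono) simp
      then show ?thesis
        using abs_ge_self[of "z s k * (a k i * z s i)"] by (simp add: abs_mult ac_simps)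
    qed
    have "E' s = 2 * (\<Sum>k\<in>J. \<Sum>i\<in>J. z s k * (a k i * z s i))"
      by (simp add: E'_def sum_distrib_left mult.assoc)
    also have "\<dots> \<le> 2 * (\<Sum>k\<in>J. \<Sum>i\<in>J. \<bar>a k i\<bar> * E s)"
      by (intro mult_left_mono sum_mono *) auto
    finally show ?thesis by (simp add: K_def sum_distrib_right sum_distrib_left mult.assoc)
  qed
  have E: "(E has_real_derivative E' s) (at s within {0..})" if "0 \<le> s" for s
    unfolding E_def E'_def using deriv that
    by (auto intro!: derivative_eq_intros sum.cong)
  \<comment> \<open>The integrating factor turns \<open>E' \<le> K E\<close> into monotonicity:
    \<open>H\<close> is nonincreasing and starts at 0, so the energy cannot become positive.\<close>
  define H where "H = (\<lambda>s. exp (- K * s) * E s)"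
  have H: "(H has_real_derivative exp (- K * s) * (E' s - K * E s)) (at s within {0..})"
    if "0 \<le> s" for s
    unfolding H_def using E[OF that]
    by (auto intro!: derivative_eq_intros simp: algebra_simps)
  have "H t \<le> H 0"
  proof (rule DERIV_nonpos_imp_decreasing_open[OF \<open>0 \<le> t\<close>])
    fix s assume "0 < s" "s < t"
    then have "(H has_real_derivative exp (- K * s) * (E' s - K * E s)) (at s)"
      using H[of s] at_within_interior[of s "{0..}"] by (simp add: interior_real_atLeast)
    moreover have "exp (- K * s) * (E' s - K * E s) \<le> 0"
      using E'_le[of s] by (simp add: mult_le_0_iff)
    ultimately show "\<exists>d. DERIV H s :> d \<and> d \<le> 0" by blast
  next
    have "continuous_on {0..} H" by (rule DERIV_continuous_on) (use H in auto)
    then show "continuous_on {0..t} H" by (rule continuous_on_subset) auto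
  qed
  moreover have "H 0 = 0" using init by (simp add: H_def E_def)
  ultimately have "E t \<le> 0" by (simp add: H_def mult_le_0_iff)
  then show ?thesis using zE[OF \<open>j \<in> J\<close>, of t] zero_le_power2[of "z t j"]
    by (metis order.antisym order.trans power_eq_0_iff)
qed

text \<open>The reduction to first order: \<open>Inl x\<close> indexes the position \<open>u t x\<close> and \<open>Inr x\<close> the velocity.\<close>

definition companion :: "('a \<Rightarrow> 'a \<Rightarrow> real) \<Rightarrow> 'a + 'a \<Rightarrow> 'a + 'a \<Rightarrow> real" where
  "companion A p q = (case (p, q) of
     (Inl x, Inr y) \<Rightarrow> of_bool (x = y) | (Inr x, Inl y) \<Rightarrow> A x y | _ \<Rightarrow> 0)"

lemma sum_companion:
  assumes "finite I"
  shows "x \<in> I \<Longrightarrow> (\<Sum>q\<in>I <+> I. companion A (Inl x) q * z q) = z (Inr x)"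
    and "(\<Sum>q\<in>I <+> I. companion A (Inr x) q * z q) = (\<Sum>y\<in>I. A x y * z (Inl y))"
  using assms by (auto simp: companion_def sum.Plus of_bool_def if_distrib[of "\<lambda>c. c * _"] cong: if_cong)

text \<open>The velocity is returned as a function \<open>v\<close> of its own, so both derivatives
  and both initial conditions can be stated without a derivative operator.\<close>

lemma linear_ode2_exists:
  fixes A :: "'a \<Rightarrow> 'a \<Rightarrow> real"
  assumes I: "finite I" and F: "\<And>x. x \<in> I \<Longrightarrow> continuous_on {0..} (\<lambda>t. F t x)"
  shows "\<exists>u v. \<forall>x\<in>I. u 0 x = g x \<and> v 0 x = h x \<and>
    (\<forall>t\<ge>0. ((\<lambda>t. u t x) has_real_derivative v t x) (at t within {0..}) \<and>
           ((\<lambda>t. v t x) has_real_derivative (\<Sum>y\<in>I. A x y * u t y) + F t x) (at t within {0..}))"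
proof -
  \<comment> \<open>The source acts on the velocity components only; the equation
    \<open>u' = v\<close> carries none.\<close>
  have "continuous_on {0..} (\<lambda>t. case_sum (\<lambda>_. 0) (F t) p)" if "p \<in> I <+> I" for p
    using that F by auto
  note linear_ode_exists[where F = "\<lambda>t. case_sum (\<lambda>_. 0) (F t)" and a = "companion A" and
    c = "case_sum g h", OF finite_Plus[OF I I] this]
  then obtain y where y0: "\<And>p. p \<in> I <+> I \<Longrightarrow> y 0 p = case_sum g h p"
    and y: "\<And>p t. p \<in> I <+> I \<Longrightarrow> 0 \<le> t \<Longrightarrow> ((\<lambda>t. y t p) has_real_derivative
      (\<Sum>q\<in>I <+> I. companion A p q * y t q) + case_sum (\<lambda>_. 0) (F t) p) (at t within {0..})"
    by blast
  show ?thesis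
  proof (rule exI[of _ "\<lambda>t x. y t (Inl x)"], rule exI[of _ "\<lambda>t x. y t (Inr x)"],
      intro ballI conjI allI impI)
    fix x and t :: real assume "x \<in> I" "0 \<le> t"
    then show "((\<lambda>t. y t (Inl x)) has_real_derivative y t (Inr x)) (at t within {0..})"
      "((\<lambda>t. y t (Inr x)) has_real_derivative (\<Sum>z\<in>I. A x z * y t (Inl z)) + F t x) (at t within {0..})"
      using y[of "Inl x" t] y[of "Inr x" t] I by (auto simp: sum_companion InlI InrI)
  qed (simp_all add: y0 InlI InrI)
qed

text \<open>The homogeneous case suffices for uniqueness, since the forcing cancels in the
  difference of two solutions.\<close>

lemma linear_ode2_zero:
  fixes A :: "'a \<Rightarrow> 'a \<Rightarrow> real"
  assumes I: "finite I"
    and "\<And>x. x \<in> I \<Longrightarrow> u 0 x = 0" "\<And>x. x \<in> I \<Longrightarrow> v 0 x = 0"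
    and "\<And>x t. x \<in> I \<Longrightarrow> 0 \<le> t \<Longrightarrow> ((\<lambda>t. u t x) has_real_derivative v t x) (at t within {0..})"
    and "\<And>x t. x \<in> I \<Longrightarrow> 0 \<le> t \<Longrightarrow>
      ((\<lambda>t. v t x) has_real_derivative (\<Sum>y\<in>I. A x y * u t y)) (at t within {0..})"
    and "x \<in> I" "0 \<le> t"
  shows "u t x = 0"
proof -
  have "case_sum (u t) (v t) (Inl x) = 0"
    by (rule linear_ode_zero[of "I <+> I" "\<lambda>t. case_sum (u t) (v t)" "companion A"])
      (use assms in \<open>auto simp: sum_companion\<close>)
  then show ?thesis by simp
qed

section \<open>The wave equation\<close>

text \<open>The diagonal sum runs over all neighbours in \<open>G\<close>, also those outside the
  interior: they carry the value 0 but still contribute their weight. A loop cancels between the two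
  summands.\<close>

definition dirichlet_matrix ::
  "'a pair_pre_digraph \<Rightarrow> ('a \<Rightarrow> 'a \<Rightarrow> real) \<Rightarrow> ('a \<Rightarrow> real) \<Rightarrow> 'a \<Rightarrow> 'a \<Rightarrow> real"
where
  "dirichlet_matrix G \<omega> \<mu> x y =
     (of_bool ((x, y) \<in> parcs G) * \<omega> x y
        - of_bool (x = y) * (\<Sum>z | (x, z) \<in> parcs G. \<omega> x z)) / \<mu> x"

lemma dirichlet_laplacian_eq_matrix:
  assumes fin: "finite {y. (x, y) \<in> parcs G}" and I: "finite (graph_interior G \<Omega>)"
    and x: "x \<in> graph_interior G \<Omega>"
  shows "dirichlet_laplacian G \<omega> \<mu> \<Omega> v x =
    (\<Sum>y\<in>graph_interior G \<Omega>. dirichlet_matrix G \<omega> \<mu> x y * v y)"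
proof -
  let ?I = "graph_interior G \<Omega>" and ?N = "{y. (x, y) \<in> parcs G}"
  \<comment> \<open>Both sums live on the intersection of \<open>?N\<close> and \<open>?I\<close>;
    elsewhere their summands vanish.\<close>
  have "(\<Sum>y\<in>?N. \<omega> x y * (if y \<in> ?I then v y else 0))
      = (\<Sum>y\<in>?I. of_bool ((x, y) \<in> parcs G) * \<omega> x y * v y)"
    using fin I by (intro sum.mono_neutral_cong) auto
  moreover have "(\<Sum>y\<in>?I. of_bool (x = y) * sum (\<omega> x) ?N * v y) = sum (\<omega> x) ?N * v x"
    using I x by (simp add: of_bool_def if_distrib[of "\<lambda>c. c * _"] cong: if_cong)
  ultimately show ?thesis
    unfolding dirichlet_laplacian_def dirichlet_matrix_def right_diff_distrib sum_subtractf
    by (simp add: left_diff_distrib diff_divide_distrib sum_subtractf flip: sum_divide_distrib sum_distrib_right)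
qed

text \<open>The derivative is unique because every \<open>t \<ge> 0\<close>, including 0, is a limit
  point of the half-line. Agreement at nonnegative times is enough, which suits functions restricted
  to such times.\<close>

lemma time_deriv_eqI:
  assumes "((\<lambda>t. w t) has_real_derivative d) (at t within {0..})" and "0 \<le> t"
    and "\<And>s. 0 \<le> s \<Longrightarrow> u (s, x) = w s"
  shows "time_deriv u (t, x) = d"
proof -
  have "((\<lambda>s. u (s, x)) has_vector_derivative d) (at t within {0..})"
    using assms by (intro has_vector_derivative_transform[of t "{0..}" "\<lambda>s. u (s, x)" w])
      (auto simp: has_real_derivative_iff_has_vector_derivative)
  moreover have "at t within {0..} \<noteq> bot"
    using \<open>0 \<le> t\<close> islimpt_subset[of t "{t..t + 1}" "{0..}"] by (simp add: trivial_limit_within)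
  ultimately show ?thesis
    by (simp add: time_deriv_def vector_derivative_within)
qed

lemma time_deriv_works:
  assumes "(\<lambda>t. u (t, x)) differentiable_on {0..}" and "0 \<le> t"
  shows "((\<lambda>t. u (t, x)) has_real_derivative time_deriv u (t, x)) (at t within {0..})"
  using assms unfolding differentiable_on_def time_deriv_def
  by (auto simp: has_real_derivative_iff_has_vector_derivative simp flip: vector_derivative_works)

text \<open>Solutions are taken as extensional functions, whose values off
  \<open>{0..} \<times> \<Omega>\<close> are fixed, so that uniqueness is plain equality. On the
  interior the matrix system determines them, on the boundary the zero condition does.\<close>

theorem theorem1p2:
  fixes G :: "'a pair_pre_digraph"
    and \<omega> :: "'a \<Rightarrow> 'a \<Rightarrow> real" and \<mu> :: "'a \<Rightarrow> real" and \<Omega> :: "'a set"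
    and f :: "real \<times> 'a \<Rightarrow> real" and g h :: "'a \<Rightarrow> real"
  assumes "weighted_graph G \<omega> \<mu>"
    and "graph_domain G \<Omega>"
    and "graph_interior G \<Omega> \<noteq> {}"
    and "\<And>x. x \<in> graph_interior G \<Omega> \<Longrightarrow> continuous_on {0..} (\<lambda>t. f (t, x))"
    and "\<exists>\<alpha>>0. \<exists>c>0. \<forall>t\<ge>0. \<forall>s\<ge>0.
           l2_norm \<mu> (graph_interior G \<Omega>) (\<lambda>x. f (t, x) - f (s, x)) \<le> c * \<bar>t - s\<bar> powr \<alpha>"
  shows "\<exists>!u \<in> ({0..} \<times> \<Omega>) \<rightarrow>\<^sub>E (UNIV :: real set). wave_solution G \<omega> \<mu> \<Omega> f g h u"
proof -
  interpret weighted_graph G \<omega> \<mu> by fact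
  let ?I = "graph_interior G \<Omega>" and ?B = "graph_boundary G \<Omega>" and ?A = "dirichlet_matrix G \<omega> \<mu>"
  have I: "finite ?I"
    using assms(2) pair_finite_verts
    by (auto simp: graph_domain_def graph_interior_def intro: finite_subset)
  have \<Omega>: "x \<in> ?I \<Longrightarrow> x \<in> \<Omega>" "x \<in> ?B \<Longrightarrow> x \<in> \<Omega>" "x \<in> ?B \<Longrightarrow> x \<notin> ?I"
    "x \<in> \<Omega> \<Longrightarrow> x \<in> ?I \<or> x \<in> ?B" for x
    by (auto simp: graph_interior_def graph_boundary_def)
  have "finite {y. (x, y) \<in> parcs G}" for x
    using finite_imageI[OF pair_finite_arcs, of snd] by (rule finite_subset[rotated]) force
  note lap = dirichlet_laplacian_eq_matrix[OF this I]
  obtain U V where UV: "\<And>x. x \<in> ?I \<Longrightarrow> U 0 x = g x" "\<And>x. x \<in> ?I \<Longrightarrow> V 0 x = h x"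
    "\<And>x t. x \<in> ?I \<Longrightarrow> 0 \<le> t \<Longrightarrow> ((\<lambda>t. U t x) has_real_derivative V t x) (at t within {0..})"
    "\<And>x t. x \<in> ?I \<Longrightarrow> 0 \<le> t \<Longrightarrow> ((\<lambda>t. V t x) has_real_derivative
        (\<Sum>y\<in>?I. ?A x y * U t y) + f (t, x)) (at t within {0..})"
    using linear_ode2_exists[OF I, of "\<lambda>t x. f (t, x)" g h ?A] assms(4) by blast
  \<comment> \<open>The right-hand side of the system, which serves as the second time derivative of
    \<open>U\<close>.\<close>
  define W where "W = (\<lambda>t x. (\<Sum>y\<in>?I. ?A x y * U t y) + f (t, x))"
  let ?ext = "\<lambda>w t x. if x \<in> ?I then w t x else (0::real)"
  define u where "u = restrict (\<lambda>(t, x). ?ext U t x) ({0..} \<times> \<Omega>)"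
  have u: "u (t, x) = ?ext U t x" if "x \<in> \<Omega>" "0 \<le> t" for x t
    using that by (simp add: u_def)
  have dU: "((\<lambda>t. ?ext U t x) has_real_derivative ?ext V t x) (at t within {0..})"
    and dV: "((\<lambda>t. ?ext V t x) has_real_derivative ?ext W t x) (at t within {0..})"
    if "0 \<le> t" for x t
    using UV(3,4) that by (auto simp: W_def)
  have u1: "time_deriv u (t, x) = ?ext V t x" if "x \<in> \<Omega>" "0 \<le> t" for x t
    by (rule time_deriv_eqI[OF dU]) (use that u in auto)
  have u2: "time_deriv (time_deriv u) (t, x) = ?ext W t x" if "x \<in> \<Omega>" "0 \<le> t" for x t
    by (rule time_deriv_eqI[OF dV]) (use that u1 in auto)
  \<comment> \<open>Continuity of the second derivative is read off the equation: \<open>U\<close>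
    is differentiable, hence continuous, and \<open>f\<close> is continuous in time.\<close>
  have contW: "continuous_on {0..} (\<lambda>t. ?ext W t x)" for x
  proof (cases "x \<in> ?I")
    case True
    have "continuous_on {0..} (\<lambda>t. U t y)" if "y \<in> ?I" for y
      using UV(3)[OF that] by (intro DERIV_continuous_on) auto
    then show ?thesis using True assms(4) by (auto simp: W_def intro!: continuous_intros)
  qed simp
  have "time_C2 \<Omega> u"
    unfolding time_C2_def
  proof (intro ballI conjI)
    fix x assume x: "x \<in> \<Omega>"
    show "(\<lambda>t. u (t, x)) differentiable_on {0..}"
      unfolding differentiable_on_def real_differentiable_def
      using has_field_derivative_transform_within[OF dU zero_less_one] u[OF x] by (metis atLeast_iff)
    show "(\<lambda>t. time_deriv u (t, x)) differentiable_on {0..}"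
      unfolding differentiable_on_def real_differentiable_def
      using has_field_derivative_transform_within[OF dV zero_less_one] u1[OF x] by (metis atLeast_iff)
    show "continuous_on {0..} (\<lambda>t. time_deriv (time_deriv u) (t, x))"
      using continuous_on_eq[OF contW[of x]] u2[OF x] by (metis atLeast_iff)
  qed
  then have sol: "wave_solution G \<omega> \<mu> \<Omega> f g h u"
    unfolding wave_solution_def using UV(1,2) by (simp add: lap \<Omega>(1-3) u u1 u2 W_def)
  have uniq: "w = u" if w: "w \<in> ({0..} \<times> \<Omega>) \<rightarrow>\<^sub>E UNIV" "wave_solution G \<omega> \<mu> \<Omega> f g h w" for w
  proof (rule PiE_ext[OF w(1)])
    show "u \<in> ({0..} \<times> \<Omega>) \<rightarrow>\<^sub>E UNIV" by (simp add: u_def)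
    have C2: "time_C2 \<Omega> w" and eq: "\<And>t x. 0 \<le> t \<Longrightarrow> x \<in> ?I \<Longrightarrow>
        time_deriv (time_deriv w) (t, x) = (\<Sum>y\<in>?I. ?A x y * w (t, y)) + f (t, x)"
      and init: "\<And>x. x \<in> ?I \<Longrightarrow> w (0, x) = g x" "\<And>x. x \<in> ?I \<Longrightarrow> time_deriv w (0, x) = h x"
      and bdry: "\<And>t x. 0 \<le> t \<Longrightarrow> x \<in> ?B \<Longrightarrow> w (t, x) = 0"
      using w(2) by (auto simp: wave_solution_def lap algebra_simps)
    \<comment> \<open>The difference has zero initial data and solves the homogeneous
      system.\<close>
    have "w (t, x) - U t x = 0" if "x \<in> ?I" "0 \<le> t" for x t
    proof (rule linear_ode2_zero[OF I, of "\<lambda>t x. w (t, x) - U t x"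
          "\<lambda>t x. time_deriv w (t, x) - V t x" ?A])
      fix x t assume x: "x \<in> ?I" "0 \<le> (t::real)"
      then have "(\<lambda>t. w (t, x)) differentiable_on {0..}"
        "(\<lambda>t. time_deriv w (t, x)) differentiable_on {0..}"
        using C2 \<Omega> by (auto simp: time_C2_def)
      from this[THEN time_deriv_works, OF x(2)]
      show "((\<lambda>t. w (t, x) - U t x) has_real_derivative time_deriv w (t, x) - V t x)
          (at t within {0..})"
        "((\<lambda>t. time_deriv w (t, x) - V t x) has_real_derivative
          (\<Sum>y\<in>?I. ?A x y * (w (t, y) - U t y))) (at t within {0..})"
        using UV(3,4)[OF x] eq[OF x(2,1)]
        by (auto intro!: derivative_eq_intros simp: right_diff_distrib sum_subtractf)
    qed (use that init UV(1,2) in auto)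
    then show "w p = u p" if "p \<in> {0..} \<times> \<Omega>" for p
      using that \<Omega>(4)[of "snd p"] bdry by (auto simp: u)
  qed
  show ?thesis
    by (rule ex1I[of _ u]) (use sol uniq in \<open>auto simp: u_def\<close>)
qed

end
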